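(* For each calculus $\mathsf{S}\in\{\mathsf{S.ConstCKID},\mathsf{S.ConstCKMP},\mathsf{S.ConstCKMPID}\}$: the rules $\mathsf{w_L}$ (from $\Gamma\Rightarrow\Delta$ infer $\Gamma,\varphi\Rightarrow\Delta$), $\mathsf{w_R}$ (from $\Gamma\Rightarrow$ infer $\Gamma\Rightarrow\varphi$) and $\mathsf{c}$ (from $\Gamma,\varphi,\varphi\Rightarrow\Delta$ infer $\Gamma,\varphi\Rightarrow\Delta$) are height-preserving admissible in $\mathsf{S}$, and the rule $\mathsf{cut}$ (from $\Gamma\Rightarrow\varphi$ and $\Gamma',\varphi\Rightarrow\Delta$ infer $\Gamma,\Gamma'\Rightarrow\Delta$) is admissible in $\mathsf{S}$.
   Context: Language $\mathcal{L}$: formulas $\varphi ::= p \mid \bot \mid \varphi\wedge\varphi \mid \varphi\vee\varphi \mid \varphi\to\varphi \mid \varphi \mathrel{\Box\!\!\to} \varphi \mid \varphi \mathrel{\Diamond\!\!\to}\varphi$. A sequent $\Gamma\Rightarrow\Delta$ is a pair of finite multisets with $|\Delta|\le1$; $\varphi\Leftrightarrow\rho$ abbreviates $\varphi\Rightarrow\rho$ and $\rho\Rightarrow\varphi$. Throughout $0\le|\Delta|\le1$, $n\ge0$. Propositional rules (premisses / conclusion): init: $\Gamma,p\Rightarrow p$; $\bot_L$: $\Gamma,\bot\Rightarrow\Delta$; $\wedge_L$: $\Gamma,\varphi,\psi\Rightarrow\Delta$ / $\Gamma,\varphi\wedge\psi\Rightarrow\Delta$; $\wedge_R$: $\Gamma\Rightarrow\varphi$,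 $\Gamma\Rightarrow\psi$ / $\Gamma\Rightarrow\varphi\wedge\psi$; $\vee_L$: $\Gamma,\varphi\Rightarrow\Delta$, $\Gamma,\psi\Rightarrow\Delta$ / $\Gamma,\varphi\vee\psi\Rightarrow\Delta$; $\vee_R^1$: $\Gamma\Rightarrow\varphi$ / $\Gamma\Rightarrow\varphi\vee\psi$; $\vee_R^2$: $\Gamma\Rightarrow\psi$ / $\Gamma\Rightarrow\varphi\vee\psi$; $\to_R$: $\Gamma,\varphi\Rightarrow\psi$ / $\Gamma\Rightarrow\varphi\to\psi$; $\to_L$: $\Gamma,\varphi\to\psi\Rightarrow\varphi$, $\Gamma,\psi\Rightarrow\Delta$ / $\Gamma,\varphi\to\psi\Rightarrow\Delta$. Write $B:=\rho_1\mathrel{\Box\!\!\to}\sigma_1,\dots,\rho_n\mathrel{\Box\!\!\to}\sigma_n$ and $E:=\{\varphi\Leftrightarrow\rho_i\}_{i\le n}$. Conditional rules: $\Box$: $E$, $\sigma_1,\dots,\sigma_n\Rightarrow\psi$ / $\Gamma,B\Rightarrow\varphi\mathrel{\Box\!\!\to}\psi$; $\Diamond$: $E$, $\varphi\Leftrightarrow\eta$, $\sigma_1,\dots,\sigma_n,\psi\Rightarrow\vartheta$ / $\Gamma,B,\varphi\mathrel{\Diamond\!\!\to}\psi\Rightarrow\eta\mathrel{\Diamond\!\!\to}\vartheta$; $\Box\Diamond$: $E$, $\sigma_1,\dots,\sigma_n,\psi\Rightarrow$ / $\Gamma,B,\varphi\mathrel{\Diamond\!\!\to}\psi\Rightarrow\Delta$;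 $\Box^{id}$: $E$, $\sigma_1,\dots,\sigma_n,\varphi\Rightarrow\psi$ / $\Gamma,B\Rightarrow\varphi\mathrel{\Box\!\!\to}\psi$; $\Box\Diamond^{id}$: $E$, $\sigma_1,\dots,\sigma_n,\varphi,\psi\Rightarrow$ / $\Gamma,B,\varphi\mathrel{\Diamond\!\!\to}\psi\Rightarrow\Delta$; $\Diamond^{id}$: $E$, $\varphi\Leftrightarrow\eta$, $\sigma_1,\dots,\sigma_n,\varphi,\psi\Rightarrow\vartheta$ / $\Gamma,B,\varphi\mathrel{\Diamond\!\!\to}\psi\Rightarrow\eta\mathrel{\Diamond\!\!\to}\vartheta$; $\mathsf{mp}_\Box$: $\Gamma,\varphi\mathrel{\Box\!\!\to}\psi\Rightarrow\varphi$, $\Gamma,\varphi\mathrel{\Box\!\!\to}\psi,\psi\Rightarrow\Delta$ / $\Gamma,\varphi\mathrel{\Box\!\!\to}\psi\Rightarrow\Delta$; $\mathsf{mp}_\Diamond$: $\Gamma\Rightarrow\varphi$, $\Gamma\Rightarrow\psi$ / $\Gamma\Rightarrow\varphi\mathrel{\Diamond\!\!\to}\psi$. Calculi: $\mathsf{S.ConstCKID}$ = propositional rules + $\Box^{id}$, $\Diamond^{id}$, $\Box\Diamond^{id}$; $\mathsf{S.ConstCKMP}$ = propositional rules + $\Box$, $\Diamond$, $\Box\Diamond$, $\mathsf{mp}_\Box$, $\mathsf{mp}_\Diamond$; $\mathsf{S.ConstCKMPID}$ = propositional rules + $\Box^{id}$, $\Diamond^{id}$, $\Box\Diamond^{id}$,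 $\mathsf{mp}_\Box$, $\mathsf{mp}_\Diamond$. Height of a derivation: length of its longest branch minus 1. A rule is admissible if its conclusion is derivable whenever its premisses are; height-preserving admissible if moreover the conclusion has a derivation of height at most the maximal height of the given derivations of the premisses. *)

theory Defs
  imports "HOL-Library.Multiset"
begin

datatype 'a form =
    Atom 'a
  | Bot
  | And "'a form" "'a form"
  | Or "'a form" "'a form"
  | Imp "'a form" "'a form"
  | BoxArr "'a form" "'a form"
  | DiaArr "'a form" "'a form"

datatype calc = ConstCKID | ConstCKMP | ConstCKMPID

definition hasID :: "calc \<Rightarrow> bool" where
  "hasID S \<longleftrightarrow> S = ConstCKID \<or> S = ConstCKMPID"

definition hasMP :: "calc \<Rightarrow> bool" where
  "hasMP S \<longleftrightarrow> S = ConstCKMP \<or> S = ConstCKMPID"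

definition boxes :: "('a form \<times> 'a form) list \<Rightarrow> 'a form multiset" where
  "boxes B = mset (map (\<lambda>(r, s). BoxArr r s) B)"

definition sigmas :: "('a form \<times> 'a form) list \<Rightarrow> 'a form multiset" where
  "sigmas B = mset (map snd B)"

text \<open>derh S n Gamma Delta: the sequent Gamma => Delta (Delta of size at most one, as an option)
  has a derivation in calculus S of height at most n.  Leaves (init, bot_L) have height 0;
  a rule application whose premisses all have height at most n gives height at most n+1.
  The premiss family E requires, for each i, derivations of phi => rho_i and rho_i => phi.\<close>
inductive derh :: "calc \<Rightarrow> nat \<Rightarrow> 'a form multiset \<Rightarrow> 'a form option \<Rightarrow> bool" where
  init: "derh S n (add_mset (Atom p) \<Gamma>) (Some (Atom p))"
| botL: "derh S n (add_mset Bot \<Gamma>) \<Delta>"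
| andL: "derh S n (add_mset A (add_mset B \<Gamma>)) \<Delta> \<Longrightarrow> derh S (Suc n) (add_mset (And A B) \<Gamma>) \<Delta>"
| andR: "derh S n \<Gamma> (Some A) \<Longrightarrow> derh S n \<Gamma> (Some B) \<Longrightarrow> derh S (Suc n) \<Gamma> (Some (And A B))"
| orL: "derh S n (add_mset A \<Gamma>) \<Delta> \<Longrightarrow> derh S n (add_mset B \<Gamma>) \<Delta> \<Longrightarrow> derh S (Suc n) (add_mset (Or A B) \<Gamma>) \<Delta>"
| orR1: "derh S n \<Gamma> (Some A) \<Longrightarrow> derh S (Suc n) \<Gamma> (Some (Or A B))"
| orR2: "derh S n \<Gamma> (Some B) \<Longrightarrow> derh S (Suc n) \<Gamma> (Some (Or A B))"
| impR: "derh S n (add_mset A \<Gamma>) (Some B) \<Longrightarrow> derh S (Suc n) \<Gamma> (Some (Imp A B))"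
| impL: "derh S n (add_mset (Imp A B) \<Gamma>) (Some A) \<Longrightarrow> derh S n (add_mset B \<Gamma>) \<Delta> \<Longrightarrow>
         derh S (Suc n) (add_mset (Imp A B) \<Gamma>) \<Delta>"
| box: "\<not> hasID S \<Longrightarrow>
        (\<forall>i<length B. derh S n {#\<phi>#} (Some (fst (B!i))) \<and> derh S n {#fst (B!i)#} (Some \<phi>)) \<Longrightarrow>
        derh S n (sigmas B) (Some \<psi>) \<Longrightarrow>
        derh S (Suc n) (\<Gamma> + boxes B) (Some (BoxArr \<phi> \<psi>))"
| dia: "\<not> hasID S \<Longrightarrow>
        (\<forall>i<length B. derh S n {#\<phi>#} (Some (fst (B!i))) \<and> derh S n {#fst (B!i)#} (Some \<phi>)) \<Longrightarrow>
        derh S n {#\<phi>#} (Some \<eta>) \<Longrightarrow> derh S n {#\<eta>#} (Some \<phi>) \<Longrightarrow>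
        derh S n (add_mset \<psi> (sigmas B)) (Some \<theta>) \<Longrightarrow>
        derh S (Suc n) (add_mset (DiaArr \<phi> \<psi>) (\<Gamma> + boxes B)) (Some (DiaArr \<eta> \<theta>))"
| boxdia: "\<not> hasID S \<Longrightarrow>
        (\<forall>i<length B. derh S n {#\<phi>#} (Some (fst (B!i))) \<and> derh S n {#fst (B!i)#} (Some \<phi>)) \<Longrightarrow>
        derh S n (add_mset \<psi> (sigmas B)) None \<Longrightarrow>
        derh S (Suc n) (add_mset (DiaArr \<phi> \<psi>) (\<Gamma> + boxes B)) \<Delta>"
| box_id: "hasID S \<Longrightarrow>
        (\<forall>i<length B. derh S n {#\<phi>#} (Some (fst (B!i))) \<and> derh S n {#fst (B!i)#} (Some \<phi>)) \<Longrightarrow>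
        derh S n (add_mset \<phi> (sigmas B)) (Some \<psi>) \<Longrightarrow>
        derh S (Suc n) (\<Gamma> + boxes B) (Some (BoxArr \<phi> \<psi>))"
| dia_id: "hasID S \<Longrightarrow>
        (\<forall>i<length B. derh S n {#\<phi>#} (Some (fst (B!i))) \<and> derh S n {#fst (B!i)#} (Some \<phi>)) \<Longrightarrow>
        derh S n {#\<phi>#} (Some \<eta>) \<Longrightarrow> derh S n {#\<eta>#} (Some \<phi>) \<Longrightarrow>
        derh S n (add_mset \<phi> (add_mset \<psi> (sigmas B))) (Some \<theta>) \<Longrightarrow>
        derh S (Suc n) (add_mset (DiaArr \<phi> \<psi>) (\<Gamma> + boxes B)) (Some (DiaArr \<eta> \<theta>))"
| boxdia_id: "hasID S \<Longrightarrow>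
        (\<forall>i<length B. derh S n {#\<phi>#} (Some (fst (B!i))) \<and> derh S n {#fst (B!i)#} (Some \<phi>)) \<Longrightarrow>
        derh S n (add_mset \<phi> (add_mset \<psi> (sigmas B))) None \<Longrightarrow>
        derh S (Suc n) (add_mset (DiaArr \<phi> \<psi>) (\<Gamma> + boxes B)) \<Delta>"
| mpBox: "hasMP S \<Longrightarrow>
        derh S n (add_mset (BoxArr \<phi> \<psi>) \<Gamma>) (Some \<phi>) \<Longrightarrow>
        derh S n (add_mset \<psi> (add_mset (BoxArr \<phi> \<psi>) \<Gamma>)) \<Delta> \<Longrightarrow>
        derh S (Suc n) (add_mset (BoxArr \<phi> \<psi>) \<Gamma>) \<Delta>"
| mpDia: "hasMP S \<Longrightarrow> derh S n \<Gamma> (Some \<phi>) \<Longrightarrow> derh S n \<Gamma> (Some \<psi>) \<Longrightarrow>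
        derh S (Suc n) \<Gamma> (Some (DiaArr \<phi> \<psi>))"

definition derivable :: "calc \<Rightarrow> 'a form multiset \<Rightarrow> 'a form option \<Rightarrow> bool" where
  "derivable S \<Gamma> \<Delta> \<longleftrightarrow> (\<exists>n. derh S n \<Gamma> \<Delta>)"

end

theory Submission
  imports Defs
begin

text \<open>
  Left weakening and contraction together say that a derivation survives, at the same height, any
  change of context that does not shrink its underlying set; this follows by induction on the
  height from height-preserving invertibility of the left rules for conjunction and disjunction
  and of the right premiss of the left rule for implication. Contexts may then be treated as sets,
  and cut is eliminated by induction on the size of the cut formula and the sum of the heights.
  The principal case of a modus ponens step against a conditional rule is solved by cutting on the
  antecedent, which derives every antecedent equivalent to it, and discharging all boxed
  consequents by modus ponens.
\<close>

section \<open>Uniform presentation of the conditional rules\<close>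

abbreviation box_of :: "'a form \<times> 'a form \<Rightarrow> 'a form" where
  "box_of p \<equiv> BoxArr (fst p) (snd p)"

text \<open>The calculi with and without identity differ only in whether the antecedent is an extra
  assumption of the main premiss. With this multiset each pair of conditional rules is treated as
  one rule.\<close>

definition id_premiss :: "calc \<Rightarrow> 'a form \<Rightarrow> 'a form multiset" where
  "id_premiss S \<phi> = (if hasID S then {#\<phi>#} else {#})"

definition equivh :: "calc \<Rightarrow> nat \<Rightarrow> 'a form \<Rightarrow> 'a form \<Rightarrow> bool" where
  "equivh S n \<phi> \<rho> \<longleftrightarrow> derh S n {#\<phi>#} (Some \<rho>) \<and> derh S n {#\<rho>#} (Some \<phi>)"

lemma boxes_image_mset: "boxes B = image_mset box_of (mset B)"
  by (auto simp: boxes_def intro!: image_mset_cong)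

lemma sigmas_image_mset: "sigmas B = image_mset snd (mset B)"
  by (simp add: sigmas_def)

lemma equivh_list_iff:
  "(\<forall>i<length B. derh S n {#\<phi>#} (Some (fst (B!i))) \<and> derh S n {#fst (B!i)#} (Some \<phi>))
     \<longleftrightarrow> (\<forall>p\<in>#mset B. equivh S n \<phi> (fst p))"
  by (simp add: equivh_def all_set_conv_all_nth)

text \<open>Subsumes \<open>derh.box\<close> and \<open>derh.box_id\<close>, exactly one of which is
  available in a given calculus. The list of the rule gives way to a multiset, since order is
  immaterial and multisets are easier to filter and merge later.\<close>

lemma derh_box:
  assumes "\<forall>p\<in>#B. equivh S n \<phi> (fst p)"
    and "derh S n (id_premiss S \<phi> + image_mset snd B) (Some \<psi>)"
  shows "derh S (Suc n) (\<Gamma> + image_mset box_of B) (Some (BoxArr \<phi> \<psi>))"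
proof -
  obtain xs where xs: "B = mset xs" using ex_mset[of B] by blast
  show ?thesis
    using assms derh.box[of S xs n \<phi> \<psi> \<Gamma>] derh.box_id[of S xs n \<phi> \<psi> \<Gamma>]
    unfolding xs equivh_list_iff boxes_image_mset sigmas_image_mset id_premiss_def
    by (cases "hasID S") simp_all
qed

lemma derh_dia:
  assumes "\<forall>p\<in>#B. equivh S n \<phi> (fst p)" and "equivh S n \<phi> \<eta>"
    and "derh S n (id_premiss S \<phi> + add_mset \<psi> (image_mset snd B)) (Some \<theta>)"
  shows "derh S (Suc n) (add_mset (DiaArr \<phi> \<psi>) (\<Gamma> + image_mset box_of B)) (Some (DiaArr \<eta> \<theta>))"
proof -
  obtain xs where xs: "B = mset xs" using ex_mset[of B] by blast
  show ?thesis
    using assms derh.dia[of S xs n \<phi> \<eta> \<psi> \<theta> \<Gamma>] derh.dia_id[of S xs n \<phi> \<eta> \<psi> \<theta> \<Gamma>]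
    unfolding xs equivh_list_iff boxes_image_mset sigmas_image_mset id_premiss_def
    by (cases "hasID S") (simp_all add: equivh_def add_mset_commute)
qed

lemma derh_boxdia:
  assumes "\<forall>p\<in>#B. equivh S n \<phi> (fst p)"
    and "derh S n (id_premiss S \<phi> + add_mset \<psi> (image_mset snd B)) None"
  shows "derh S (Suc n) (add_mset (DiaArr \<phi> \<psi>) (\<Gamma> + image_mset box_of B)) \<Delta>"
proof -
  obtain xs where xs: "B = mset xs" using ex_mset[of B] by blast
  show ?thesis
    using assms derh.boxdia[of S xs n \<phi> \<psi> \<Gamma> \<Delta>] derh.boxdia_id[of S xs n \<phi> \<psi> \<Gamma> \<Delta>]
    unfolding xs equivh_list_iff boxes_image_mset sigmas_image_mset id_premiss_def
    by (cases "hasID S") (simp_all add: add_mset_commute)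
qed

text \<open>Inversion with each conditional rule merged with its identity variant, so that seventeen
  rules become fourteen cases. Premisses that keep the principal formula are stated with the whole
  context \<open>G\<close>.\<close>

lemma derh_cases [consumes 1, case_names init botL andL andR orL orR1 orR2 impR impL
    box dia boxdia mpBox mpDia]:
  assumes "derh S n G D"
  obtains
    (init) p \<Gamma> where "G = add_mset (Atom p) \<Gamma>" "D = Some (Atom p)"
  | (botL) \<Gamma> where "G = add_mset Bot \<Gamma>"
  | (andL) m A B \<Gamma> where "n = Suc m" "G = add_mset (And A B) \<Gamma>"
      "derh S m (add_mset A (add_mset B \<Gamma>)) D"
  | (andR) m A B where "n = Suc m" "D = Some (And A B)" "derh S m G (Some A)" "derh S m G (Some B)"
  | (orL) m A B \<Gamma> where "n = Suc m" "G = add_mset (Or A B) \<Gamma>"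
      "derh S m (add_mset A \<Gamma>) D" "derh S m (add_mset B \<Gamma>) D"
  | (orR1) m A B where "n = Suc m" "D = Some (Or A B)" "derh S m G (Some A)"
  | (orR2) m A B where "n = Suc m" "D = Some (Or A B)" "derh S m G (Some B)"
  | (impR) m A B where "n = Suc m" "D = Some (Imp A B)" "derh S m (add_mset A G) (Some B)"
  | (impL) m A B \<Gamma> where "n = Suc m" "G = add_mset (Imp A B) \<Gamma>"
      "derh S m G (Some A)" "derh S m (add_mset B \<Gamma>) D"
  | (box) m \<phi> \<psi> B \<Gamma> where "n = Suc m" "G = \<Gamma> + image_mset box_of B" "D = Some (BoxArr \<phi> \<psi>)"
      "\<forall>p\<in>#B. equivh S m \<phi> (fst p)"
      "derh S m (id_premiss S \<phi> + image_mset snd B) (Some \<psi>)"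
  | (dia) m \<phi> \<psi> \<eta> \<theta> B \<Gamma> where "n = Suc m"
      "G = add_mset (DiaArr \<phi> \<psi>) (\<Gamma> + image_mset box_of B)" "D = Some (DiaArr \<eta> \<theta>)"
      "\<forall>p\<in>#B. equivh S m \<phi> (fst p)" "equivh S m \<phi> \<eta>"
      "derh S m (id_premiss S \<phi> + add_mset \<psi> (image_mset snd B)) (Some \<theta>)"
  | (boxdia) m \<phi> \<psi> B \<Gamma> where "n = Suc m"
      "G = add_mset (DiaArr \<phi> \<psi>) (\<Gamma> + image_mset box_of B)"
      "\<forall>p\<in>#B. equivh S m \<phi> (fst p)"
      "derh S m (id_premiss S \<phi> + add_mset \<psi> (image_mset snd B)) None"
  | (mpBox) m \<phi> \<psi> \<Gamma> where "n = Suc m" "hasMP S" "G = add_mset (BoxArr \<phi> \<psi>) \<Gamma>"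
      "derh S m G (Some \<phi>)" "derh S m (add_mset \<psi> G) D"
  | (mpDia) m \<phi> \<psi> where "n = Suc m" "hasMP S" "D = Some (DiaArr \<phi> \<psi>)"
      "derh S m G (Some \<phi>)" "derh S m G (Some \<psi>)"
  using assms
proof (cases rule: derh.cases)
  case (box B m \<phi> \<psi> \<Gamma>)
  then show ?thesis
    using that(10)[of m \<Gamma> "mset B" \<phi> \<psi>]
    unfolding equivh_list_iff boxes_image_mset sigmas_image_mset id_premiss_def by simp
next
  case (box_id B m \<phi> \<psi> \<Gamma>)
  then show ?thesis
    using that(10)[of m \<Gamma> "mset B" \<phi> \<psi>]
    unfolding equivh_list_iff boxes_image_mset sigmas_image_mset id_premiss_def by simp
next
  case (dia B m \<phi> \<eta> \<psi> \<theta> \<Gamma>)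
  then show ?thesis
    using that(11)[of m \<phi> \<psi> \<Gamma> "mset B" \<eta> \<theta>]
    unfolding equivh_list_iff boxes_image_mset sigmas_image_mset id_premiss_def
    by (simp add: equivh_def add_mset_commute)
next
  case (dia_id B m \<phi> \<eta> \<psi> \<theta> \<Gamma>)
  then show ?thesis
    using that(11)[of m \<phi> \<psi> \<Gamma> "mset B" \<eta> \<theta>]
    unfolding equivh_list_iff boxes_image_mset sigmas_image_mset id_premiss_def
    by (simp add: equivh_def add_mset_commute)
next
  case (boxdia B m \<phi> \<psi> \<Gamma>)
  then show ?thesis
    using that(12)[of m \<phi> \<psi> \<Gamma> "mset B"]
    unfolding equivh_list_iff boxes_image_mset sigmas_image_mset id_premiss_def by simp
next
  case (boxdia_id B m \<phi> \<psi> \<Gamma>)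
  then show ?thesis
    using that(12)[of m \<phi> \<psi> \<Gamma> "mset B"]
    unfolding equivh_list_iff boxes_image_mset sigmas_image_mset id_premiss_def
    by (simp add: add_mset_commute)
next
  case init
  then show ?thesis using that(1) by blast
next
  case botL
  then show ?thesis using that(2) by blast
next
  case andL
  then show ?thesis using that(3) by blast
next
  case andR
  then show ?thesis using that(4) by blast
next
  case orL
  then show ?thesis using that(5) by blast
next
  case orR1
  then show ?thesis using that(6) by blast
next
  case orR2
  then show ?thesis using that(7) by blast
next
  case impR
  then show ?thesis using that(8) by blast
next
  case impL
  then show ?thesis using that(9) by blast
next
  case mpBox
  then show ?thesis using that(13) by blast
next
  case mpDia
  then show ?thesis using that(14) by blast
qed

section \<open>Height-preserving structural rules\<close>

lemma derh_Suc: "derh S n \<Gamma> \<Delta> \<Longrightarrow> derh S (Suc n) \<Gamma> \<Delta>"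
  by (induction rule: derh.induct) (simp_all add: derh.intros)

lemma derh_le: "n \<le> m \<Longrightarrow> derh S n \<Gamma> \<Delta> \<Longrightarrow> derh S m \<Gamma> \<Delta>"
  by (induction rule: dec_induct) (auto intro: derh_Suc)

text \<open>Pairs a principal formula on the left with what one premiss puts in its place. For
  implication only the right premiss is listed, because the left one keeps \<open>Imp A B\<close>.
  Boxed formulas need no entry, because \<open>mpBox\<close> keeps its principal formula in both
  premisses.\<close>

inductive left_inv :: "'a form \<Rightarrow> 'a form multiset \<Rightarrow> bool" where
  "left_inv (And A B) {#A, B#}"
| "left_inv (Or A B) {#A#}"
| "left_inv (Or A B) {#B#}"
| "left_inv (Imp A B) {#B#}"

text \<open>An invertible formula is never boxed, so in the conclusion of a conditional rule it
  belongs to the weakening context.\<close>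

lemma left_inv_context:
  assumes "left_inv C M" and "add_mset C G = \<Gamma> + image_mset box_of B"
  obtains \<Gamma>' where "\<Gamma> = add_mset C \<Gamma>'" "G = \<Gamma>' + image_mset box_of B"
proof -
  have "C \<in># \<Gamma> + image_mset box_of B" by (simp flip: assms(2))
  moreover have "C \<notin># image_mset box_of B" using assms(1) by (auto elim!: left_inv.cases)
  ultimately obtain \<Gamma>' where "\<Gamma> = add_mset C \<Gamma>'" by (metis multi_member_split union_iff)
  with assms(2) that show ?thesis by auto
qed

text \<open>If \<open>C\<close> is principal, a premiss already is the wanted sequent, with height
  to spare. Otherwise inversion is applied to the premisses and the rule is repeated. Under a
  conditional rule \<open>C\<close> sits in the weakening context and is exchanged there for
  \<open>M\<close>, with the premisses untouched.\<close>

lemma derh_left_inv: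
  assumes inv: "left_inv C M"
  shows "derh S n (add_mset C G) D \<Longrightarrow> derh S n (M + G) D"
proof (induction n arbitrary: G D rule: less_induct)
  case (less n)
  have split: "(C = P \<and> G = \<Gamma>) \<or> (\<exists>K. G = add_mset P K \<and> \<Gamma> = add_mset C K)"
    if "add_mset C G = add_mset P \<Gamma>" for P \<Gamma>
    using that by (auto simp: add_eq_conv_ex)
  have IH: "derh S m (M + K) E" if "derh S m H E" "m < n" "H = add_mset C K" for m H K E
    using less.IH that by blast
  from less.prems show ?case
  proof (cases rule: derh_cases)
    case (init p \<Gamma>)
    then obtain K where "G = add_mset (Atom p) K"
      using split[OF init(1)] inv by (auto elim: left_inv.cases)
    then show ?thesis using init derh.init by simp
  next
    case (botL \<Gamma>)
    then obtain K where "G = add_mset Bot K"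
      using split[OF botL(1)] inv by (auto elim: left_inv.cases)
    then show ?thesis using derh.botL by simp
  next
    case (andL m A B \<Gamma>)
    from split[OF andL(2)] show ?thesis
    proof (elim disjE exE conjE)
      assume "C = And A B" "G = \<Gamma>"
      with inv andL show ?thesis by (auto elim!: left_inv.cases intro: derh_Suc)
    next
      fix K assume "G = add_mset (And A B) K" "\<Gamma> = add_mset C K"
      with IH[OF andL(3), of "add_mset A (add_mset B K)"] andL(1) show ?thesis
        by (auto simp: add_mset_commute intro: derh.andL)
    qed
  next
    case (andR m A B)
    with IH[OF andR(3), of G] IH[OF andR(4), of G] show ?thesis by (auto intro: derh.andR)
  next
    case (orL m A B \<Gamma>)
    from split[OF orL(2)] show ?thesis
    proof (elim disjE exE conjE)
      assume "C = Or A B" "G = \<Gamma>"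
      with inv orL show ?thesis by (auto elim!: left_inv.cases intro: derh_Suc)
    next
      fix K assume "G = add_mset (Or A B) K" "\<Gamma> = add_mset C K"
      with IH[OF orL(3), of "add_mset A K"] IH[OF orL(4), of "add_mset B K"] orL(1) show ?thesis
        by (auto simp: add_mset_commute intro: derh.orL)
    qed
  next
    case (orR1 m A B)
    with IH[OF orR1(3), of G] show ?thesis by (auto intro: derh.orR1)
  next
    case (orR2 m A B)
    with IH[OF orR2(3), of G] show ?thesis by (auto intro: derh.orR2)
  next
    case (impR m A B)
    with IH[OF impR(3), of "add_mset A G"] show ?thesis
      by (auto simp: add_mset_commute intro: derh.impR)
  next
    case (impL m A B \<Gamma>)
    from split[OF impL(2)] show ?thesis
    proof (elim disjE exE conjE)
      assume "C = Imp A B" "G = \<Gamma>"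
      with inv impL show ?thesis by (auto elim!: left_inv.cases intro: derh_Suc)
    next
      fix K assume "G = add_mset (Imp A B) K" "\<Gamma> = add_mset C K"
      with IH[OF impL(3), of G] IH[OF impL(4), of "add_mset B K"] impL(1) show ?thesis
        by (auto simp: add_mset_commute intro: derh.impL)
    qed
  next
    case (box m \<phi> \<psi> B \<Gamma>)
    from left_inv_context[OF inv box(2)] obtain \<Gamma>' where "G = \<Gamma>' + image_mset box_of B" .
    then show ?thesis using box derh_box[of B S m \<phi> \<psi> "M + \<Gamma>'"] by (simp add: add.assoc)
  next
    case (dia m \<phi> \<psi> \<eta> \<theta> B \<Gamma>)
    then obtain K where K: "G = add_mset (DiaArr \<phi> \<psi>) K" "\<Gamma> + image_mset box_of B = add_mset C K"
      using split[OF dia(2)] inv by (auto elim: left_inv.cases)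
    from left_inv_context[OF inv K(2)[symmetric]] obtain \<Gamma>' where "K = \<Gamma>' + image_mset box_of B" .
    then show ?thesis using dia K derh_dia[of B S m \<phi> \<eta> \<psi> \<theta> "M + \<Gamma>'"] by (simp add: add.assoc)
  next
    case (boxdia m \<phi> \<psi> B \<Gamma>)
    then obtain K where K: "G = add_mset (DiaArr \<phi> \<psi>) K" "\<Gamma> + image_mset box_of B = add_mset C K"
      using split[OF boxdia(2)] inv by (auto elim: left_inv.cases)
    from left_inv_context[OF inv K(2)[symmetric]] obtain \<Gamma>' where "K = \<Gamma>' + image_mset box_of B" .
    then show ?thesis using boxdia K derh_boxdia[of B S m \<phi> \<psi> "M + \<Gamma>'"] by (simp add: add.assoc)
  next
    case (mpBox m \<phi> \<psi> \<Gamma>)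
    then obtain K where K: "G = add_mset (BoxArr \<phi> \<psi>) K"
      using split[OF mpBox(3)] inv by (auto elim: left_inv.cases)
    with mpBox IH[OF mpBox(4), of G] IH[OF mpBox(5), of "add_mset \<psi> G"] show ?thesis
      by (auto simp: add_mset_commute intro: derh.mpBox)
  next
    case (mpDia m \<phi> \<psi>)
    with IH[OF mpDia(4), of G] IH[OF mpDia(5), of G] show ?thesis by (auto intro: derh.mpDia)
  qed
qed

text \<open>The inclusion of sets says nothing about multiplicities, so \<open>B'\<close> takes
  every pair of \<open>B\<close> just once. As \<open>box_of\<close> is injective, the boxes of
  \<open>B'\<close> are distinct, and each occurs at least once in \<open>G\<close>.\<close>

lemma box_context_mono:
  assumes "set_mset (image_mset box_of B) \<subseteq> set_mset G"
  obtains \<Gamma> B' where "G = \<Gamma> + image_mset box_of B'" "set_mset B' = set_mset B"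
proof -
  let ?B = "mset_set (set_mset B)"
  have "inj_on box_of (set_mset B)" by (auto intro!: inj_onI simp: prod_eq_iff)
  then have "image_mset box_of ?B = mset_set (box_of ` set_mset B)" by (rule image_mset_mset_set)
  also have "\<dots> \<subseteq># mset_set (set_mset G)" using assms by (auto intro: subset_imp_msubset_mset_set)
  also have "\<dots> \<subseteq># G" by (rule mset_set_set_mset_msubset)
  finally obtain \<Gamma> where "G = \<Gamma> + image_mset box_of ?B"
    by (metis subset_mset.diff_add)
  then show ?thesis using that by simp
qed

text \<open>Weakening and contraction are proved at once. Set inclusion places each principal
  formula of \<Gamma> in \<Gamma>'. The induction runs over heights, not over the given derivation,
  because the hypothesis is also applied to derivations produced by inversion.\<close>

lemma derh_mono:
  fixes \<Gamma> :: "'a form multiset"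
  shows "derh S n \<Gamma> \<Delta> \<Longrightarrow> set_mset \<Gamma> \<subseteq> set_mset \<Gamma>' \<Longrightarrow> derh S n \<Gamma>' \<Delta>"
proof (induction n arbitrary: \<Gamma> \<Gamma>' \<Delta> rule: less_induct)
  case (less n)
  have IH: "derh S m \<Gamma>' E" if "m < n" "derh S m \<Gamma> E" for m E
    using less.IH[OF that] less.prems(2) .
  \<comment> \<open>The rest \<open>H\<close> of the old context may contain another
    \<open>C\<close> that \<open>K\<close> lacks. So one \<open>C\<close> is first kept, then
    inverted into a second copy of \<open>M\<close>, which the induction hypothesis contracts. The
    height stays \<open>m\<close> throughout.\<close>
  have inv: "derh S m (M + K) E"
    if "left_inv C M" "m < n" "derh S m (M + H) E" "set_mset H \<subseteq> set_mset (add_mset C K)"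
    for C :: "'a form" and M m H K E
  proof -
    have "derh S m (add_mset C (M + K)) E" by (rule less.IH[OF that(2,3)]) (use that(4) in auto)
    then have "derh S m (M + (M + K)) E" by (rule derh_left_inv[OF that(1)])
    then show ?thesis by (rule less.IH[OF that(2)]) auto
  qed
  from less.prems(1) show ?case
  proof (cases rule: derh_cases)
    case (init p G)
    then show ?thesis using less.prems(2) by (auto dest!: multi_member_split intro: derh.init)
  next
    case (botL G)
    then show ?thesis using less.prems(2) by (auto dest!: multi_member_split intro: derh.botL)
  next
    case (andL m A B G)
    then obtain K where K: "\<Gamma>' = add_mset (And A B) K"
      using less.prems(2) by (auto dest!: multi_member_split)
    then show ?thesis
      using andL less.prems(2) inv[OF left_inv.intros(1)[of A B], of m G \<Delta> K] by (auto intro: derh.andL)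
  next
    case (andR m A B)
    then show ?thesis using IH by (auto intro: derh.andR)
  next
    case (orL m A B G)
    then obtain K where K: "\<Gamma>' = add_mset (Or A B) K"
      using less.prems(2) by (auto dest!: multi_member_split)
    then show ?thesis
      using orL less.prems(2) inv[OF left_inv.intros(2)[of A B], of m G \<Delta> K]
        inv[OF left_inv.intros(3)[of A B], of m G \<Delta> K] by (auto intro: derh.orL)
  next
    case (orR1 m A B)
    then show ?thesis using IH by (auto intro: derh.orR1)
  next
    case (orR2 m A B)
    then show ?thesis using IH by (auto intro: derh.orR2)
  next
    case (impR m A B)
    then have "derh S m (add_mset A \<Gamma>') (Some B)"
      by (intro less.IH[OF _ impR(3)]) (use less.prems(2) in auto)
    then show ?thesis using impR by (auto intro: derh.impR)
  next
    case (impL m A B G)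
    then obtain K where K: "\<Gamma>' = add_mset (Imp A B) K"
      using less.prems(2) by (auto dest!: multi_member_split)
    have "derh S m \<Gamma>' (Some A)" using impL(1,3) IH by auto
    then show ?thesis
      using impL K less.prems(2) inv[OF left_inv.intros(4)[of A B], of m G \<Delta> K]
      by (auto intro: derh.impL)
  next
    case (box m \<phi> \<psi> B G)
    then have "set_mset (image_mset box_of B) \<subseteq> set_mset \<Gamma>'" using less.prems(2) by auto
    then obtain K B' where K: "\<Gamma>' = K + image_mset box_of B'" "set_mset B' = set_mset B"
      by (rule box_context_mono)
    \<comment> \<open>Since \<open>B\<close> and \<open>B'\<close> have the same elements, the two
      main premisses have the same underlying set.\<close>
    have "derh S m (id_premiss S \<phi> + image_mset snd B') (Some \<psi>)"
      by (rule less.IH[OF _ box(5)]) (use box(1) K(2) in auto)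
    then show ?thesis using box K derh_box[of B' S m \<phi> \<psi> K] by simp
  next
    case (dia m \<phi> \<psi> \<eta> \<theta> B G)
    then obtain L where L: "\<Gamma>' = add_mset (DiaArr \<phi> \<psi>) L"
      using less.prems(2) by (auto dest!: multi_member_split)
    have "set_mset (image_mset box_of B) \<subseteq> set_mset L" using dia(2) L less.prems(2) by auto
    then obtain K B' where K: "L = K + image_mset box_of B'" "set_mset B' = set_mset B"
      by (rule box_context_mono)
    have "derh S m (id_premiss S \<phi> + add_mset \<psi> (image_mset snd B')) (Some \<theta>)"
      by (rule less.IH[OF _ dia(6)]) (use dia(1) K(2) in auto)
    then show ?thesis using dia L K derh_dia[of B' S m \<phi> \<eta> \<psi> \<theta> K] by simp
  next
    case (boxdia m \<phi> \<psi> B G)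
    then obtain L where L: "\<Gamma>' = add_mset (DiaArr \<phi> \<psi>) L"
      using less.prems(2) by (auto dest!: multi_member_split)
    have "set_mset (image_mset box_of B) \<subseteq> set_mset L" using boxdia(2) L less.prems(2) by auto
    then obtain K B' where K: "L = K + image_mset box_of B'" "set_mset B' = set_mset B"
      by (rule box_context_mono)
    have "derh S m (id_premiss S \<phi> + add_mset \<psi> (image_mset snd B')) None"
      by (rule less.IH[OF _ boxdia(4)]) (use boxdia(1) K(2) in auto)
    then show ?thesis using boxdia L K derh_boxdia[of B' S m \<phi> \<psi> K] by simp
  next
    case (mpBox m \<phi> \<psi> G)
    then obtain K where K: "\<Gamma>' = add_mset (BoxArr \<phi> \<psi>) K"
      using less.prems(2) by (auto dest!: multi_member_split)
    have "derh S m \<Gamma>' (Some \<phi>)" using mpBox(1,4) IH by auto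
    moreover have "derh S m (add_mset \<psi> \<Gamma>') \<Delta>"
      by (rule less.IH[OF _ mpBox(5)]) (use mpBox(1) less.prems(2) in auto)
    ultimately show ?thesis using mpBox(1,2) K by (auto intro: derh.mpBox)
  next
    case (mpDia m \<phi> \<psi>)
    then show ?thesis using IH by (auto intro: derh.mpDia)
  qed
qed

text \<open>With an empty succedent the last rule is \<open>botL\<close>, a left rule passing the
  succedent to a premiss, or \<open>boxdia\<close>. The first and the last allow any succedent in
  the conclusion, and the others are handled by induction.\<close>

lemma derh_weaken_right: "derh S n \<Gamma> None \<Longrightarrow> derh S n \<Gamma> \<Delta>"
proof (induction n arbitrary: \<Gamma>)
  case 0
  then show ?case by (cases rule: derh_cases) (simp_all add: derh.botL)
next
  case (Suc n)
  from Suc.prems show ?case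
    by (cases rule: derh_cases)
      (auto intro: Suc.IH derh.botL derh.andL derh.orL derh.impL derh.mpBox derh_boxdia)
qed

section \<open>Derivability with set-like contexts\<close>

definition equivalent :: "calc \<Rightarrow> 'a form \<Rightarrow> 'a form \<Rightarrow> bool" where
  "equivalent S \<phi> \<rho> \<longleftrightarrow> derivable S {#\<phi>#} (Some \<rho>) \<and> derivable S {#\<rho>#} (Some \<phi>)"

lemma equivh_le: "equivh S n \<phi> \<rho> \<Longrightarrow> n \<le> m \<Longrightarrow> equivh S m \<phi> \<rho>"
  by (auto simp: equivh_def intro: derh_le)

lemma equivalent_iff: "equivalent S \<phi> \<rho> \<longleftrightarrow> (\<exists>n. equivh S n \<phi> \<rho>)"
  unfolding equivalent_def derivable_def equivh_def
  by (meson derh_le nat_le_linear)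

text \<open>The conditional rules want all premisses within one height bound; as \<open>B\<close> is
  finite, a maximum exists.\<close>

lemma equivalent_uniform_height:
  "\<forall>p\<in>#B. equivalent S \<phi> (fst p) \<Longrightarrow> \<exists>n. \<forall>p\<in>#B. equivh S n \<phi> (fst p)"
proof (induction B)
  case (add q B)
  then obtain n k where "\<forall>p\<in>#B. equivh S n \<phi> (fst p)" "equivh S k \<phi> (fst q)"
    by (auto simp: equivalent_iff)
  then have "\<forall>p\<in>#add_mset q B. equivh S (max n k) \<phi> (fst p)"
    by (auto intro: equivh_le)
  then show ?case by blast
qed simp

lemma derivable_mono:
  "derivable S \<Gamma> \<Delta> \<Longrightarrow> set_mset \<Gamma> \<subseteq> set_mset \<Gamma>' \<Longrightarrow> derivable S \<Gamma>' \<Delta>"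
  unfolding derivable_def using derh_mono by blast

lemma derivable_weaken_right: "derivable S \<Gamma> None \<Longrightarrow> derivable S \<Gamma> \<Delta>"
  unfolding derivable_def using derh_weaken_right by blast

lemma derivable_common_height:
  assumes "derivable S \<Gamma> \<Delta>" "derivable S \<Gamma>' \<Delta>'"
  obtains n where "derh S n \<Gamma> \<Delta>" "derh S n \<Gamma>' \<Delta>'"
  using assms unfolding derivable_def by (meson derh_le nat_le_linear)

section \<open>The rules of the calculus over set-like contexts\<close>

lemma derivable_botL: "Bot \<in># G \<Longrightarrow> derivable S G D"
  unfolding derivable_def by (metis derh.botL multi_member_split)

lemma derivable_init: "Atom p \<in># G \<Longrightarrow> derivable S G (Some (Atom p))"
  unfolding derivable_def by (metis derh.init multi_member_split)

text \<open>The principal formula stays in the premiss. The rule then yields a second copy in the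
  conclusion, which \<open>derivable_mono\<close> absorbs. Asking only for membership in
  \<open>G\<close> avoids splitting contexts in the cut proof.\<close>

lemma derivable_andL:
  assumes "And A B \<in># G" "derivable S (add_mset A (add_mset B G)) D"
  shows "derivable S G D"
proof -
  have "derivable S (add_mset (And A B) G) D"
    using assms(2) derh.andL unfolding derivable_def by blast
  then show ?thesis by (rule derivable_mono) (use assms(1) in auto)
qed

lemma derivable_andR:
  "derivable S G (Some A) \<Longrightarrow> derivable S G (Some B) \<Longrightarrow> derivable S G (Some (And A B))"
  by (erule (1) derivable_common_height) (auto simp: derivable_def intro: derh.andR)

lemma derivable_orL:
  assumes "Or A B \<in># G" "derivable S (add_mset A G) D" "derivable S (add_mset B G) D"
  shows "derivable S G D"
proof -
  have "derivable S (add_mset (Or A B) G) D"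
    by (rule derivable_common_height[OF assms(2,3)]) (auto simp: derivable_def intro: derh.orL)
  then show ?thesis by (rule derivable_mono) (use assms(1) in auto)
qed

lemma derivable_orR:
  "derivable S G (Some A) \<Longrightarrow> derivable S G (Some (Or A B))"
  "derivable S G (Some B) \<Longrightarrow> derivable S G (Some (Or A B))"
  unfolding derivable_def by (blast intro: derh.orR1 derh.orR2)+

lemma derivable_impR:
  "derivable S (add_mset A G) (Some B) \<Longrightarrow> derivable S G (Some (Imp A B))"
  unfolding derivable_def by (blast intro: derh.impR)

lemma derivable_impL:
  assumes "Imp A B \<in># G" "derivable S G (Some A)" "derivable S (add_mset B G) D"
  shows "derivable S G D"
proof -
  have "derivable S (add_mset (Imp A B) G) (Some A)"
    using assms(2) by (rule derivable_mono) auto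
  then have "derivable S (add_mset (Imp A B) G) D"
    by (rule derivable_common_height[OF _ assms(3)]) (auto simp: derivable_def intro: derh.impL)
  then show ?thesis by (rule derivable_mono) (use assms(1) in auto)
qed

lemma derivable_mpBox:
  assumes "hasMP S" "BoxArr A B \<in># G" "derivable S G (Some A)" "derivable S (add_mset B G) D"
  shows "derivable S G D"
proof -
  obtain K where "G = add_mset (BoxArr A B) K" using assms(2) by (metis multi_member_split)
  with derivable_common_height[OF assms(3,4)] assms(1) show ?thesis
    unfolding derivable_def by (metis derh.mpBox)
qed

lemma derivable_mpDia:
  "hasMP S \<Longrightarrow> derivable S G (Some A) \<Longrightarrow> derivable S G (Some B) \<Longrightarrow>
    derivable S G (Some (DiaArr A B))"
  by (erule (1) derivable_common_height) (auto simp: derivable_def intro: derh.mpDia)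

lemma derivable_box:
  assumes "\<forall>p\<in>#B. box_of p \<in># G \<and> equivalent S \<phi> (fst p)"
    and "derivable S (id_premiss S \<phi> + image_mset snd B) (Some \<psi>)"
  shows "derivable S G (Some (BoxArr \<phi> \<psi>))"
proof -
  obtain n where n: "\<forall>p\<in>#B. equivh S n \<phi> (fst p)"
    using assms(1) equivalent_uniform_height by blast
  obtain k where k: "derh S k (id_premiss S \<phi> + image_mset snd B) (Some \<psi>)"
    using assms(2) by (auto simp: derivable_def)
  have "derivable S (G + image_mset box_of B) (Some (BoxArr \<phi> \<psi>))"
    unfolding derivable_def
    using n k by (intro exI[of _ "Suc (max n k)"] derh_box) (auto intro: equivh_le derh_le[of k])
  then show ?thesis by (rule derivable_mono) (use assms(1) in auto)
qed

lemma derivable_dia: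
  assumes "DiaArr \<phi> \<psi> \<in># G" "\<forall>p\<in>#B. box_of p \<in># G \<and> equivalent S \<phi> (fst p)"
    and "equivalent S \<phi> \<eta>"
    and "derivable S (id_premiss S \<phi> + add_mset \<psi> (image_mset snd B)) (Some \<theta>)"
  shows "derivable S G (Some (DiaArr \<eta> \<theta>))"
proof -
  \<comment> \<open>The pair \<open>(\<eta>, \<eta>)\<close> is added so that one height also covers
    the equivalence of \<phi> and \<eta>; its second component is a filler.\<close>
  have "\<forall>p\<in>#add_mset (\<eta>, \<eta>) B. equivalent S \<phi> (fst p)" using assms(2,3) by auto
  then obtain n where "\<forall>p\<in>#add_mset (\<eta>, \<eta>) B. equivh S n \<phi> (fst p)"
    using equivalent_uniform_height by blast
  then have n: "\<forall>p\<in>#B. equivh S n \<phi> (fst p)" "equivh S n \<phi> \<eta>" by auto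
  obtain k where k: "derh S k (id_premiss S \<phi> + add_mset \<psi> (image_mset snd B)) (Some \<theta>)"
    using assms(4) by (auto simp: derivable_def)
  have "derivable S (add_mset (DiaArr \<phi> \<psi>) (G + image_mset box_of B)) (Some (DiaArr \<eta> \<theta>))"
    unfolding derivable_def
    using n k by (intro exI[of _ "Suc (max n k)"] derh_dia) (auto intro: equivh_le derh_le[of k])
  then show ?thesis by (rule derivable_mono) (use assms(1,2) in auto)
qed

lemma derivable_boxdia:
  assumes "DiaArr \<phi> \<psi> \<in># G" "\<forall>p\<in>#B. box_of p \<in># G \<and> equivalent S \<phi> (fst p)"
    and "derivable S (id_premiss S \<phi> + add_mset \<psi> (image_mset snd B)) None"
  shows "derivable S G D"
proof -
  obtain n where n: "\<forall>p\<in>#B. equivh S n \<phi> (fst p)"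
    using assms(2) equivalent_uniform_height by blast
  obtain k where k: "derh S k (id_premiss S \<phi> + add_mset \<psi> (image_mset snd B)) None"
    using assms(3) by (auto simp: derivable_def)
  have "derivable S (add_mset (DiaArr \<phi> \<psi>) (G + image_mset box_of B)) D"
    unfolding derivable_def
    using n k by (intro exI[of _ "Suc (max n k)"] derh_boxdia) (auto intro: equivh_le derh_le[of k])
  then show ?thesis by (rule derivable_mono) (use assms(1,2) in auto)
qed

text \<open>Modus ponens discharges the boxed consequents one after another. The context is
  generalised because each consequent joins it before the remaining ones are discharged.\<close>

lemma derivable_mpBox_multiset:
  assumes "hasMP S"
  shows "\<forall>p\<in>#B. box_of p \<in># G \<and> derivable S G (Some (fst p)) \<Longrightarrow>
    derivable S (image_mset snd B + G) D \<Longrightarrow> derivable S G D"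
proof (induction B arbitrary: G)
  case (add q B)
  let ?G = "add_mset (snd q) G"
  have "derivable S ?G D"
  proof (rule add.IH)
    show "\<forall>p\<in>#B. box_of p \<in># ?G \<and> derivable S ?G (Some (fst p))"
      using add.prems(1) derivable_mono[of S G _ ?G] by fastforce
    show "derivable S (image_mset snd B + ?G) D" using add.prems(2) by simp
  qed
  then show ?case
    using add.prems(1) derivable_mpBox[OF assms, of "fst q" "snd q"] by auto
qed simp

section \<open>Cut\<close>

text \<open>Contexts matter only up to inclusion in \<open>G\<close>, so all copies of \<phi> on the
  right are removed together and no multicut is required. \<open>smaller\<close> is the outer
  induction hypothesis on the cut formula; the induction here is on the sum of the heights.\<close>

lemma cut_step:
  fixes \<phi> :: "'a form"
  assumes smaller: "\<And>(\<chi> :: 'a form) G D. size \<chi> < size \<phi> \<Longrightarrow> derivable S G (Some \<chi>) \<Longrightarrow>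
      derivable S (add_mset \<chi> G) D \<Longrightarrow> derivable S G D"
  shows "derh S n \<Gamma> (Some \<phi>) \<Longrightarrow> derh S m \<Gamma>' D \<Longrightarrow> set_mset \<Gamma> \<subseteq> set_mset G \<Longrightarrow>
      set_mset \<Gamma>' \<subseteq> insert \<phi> (set_mset G) \<Longrightarrow> derivable S G D"
proof (induction "n + m" arbitrary: n m \<Gamma> \<Gamma>' D G rule: less_induct)
  case less
  note left = less.prems(1) and right = less.prems(2)
    and left_sub = less.prems(3) and right_sub = less.prems(4)
  have left_der: "derivable S G (Some \<phi>)"
    using left left_sub derivable_mono unfolding derivable_def by blast
  have IHL: "derivable S G' D" if "derh S k H (Some \<phi>)" "k < n" "set_mset H \<subseteq> set_mset G'"
    "set_mset G \<subseteq> set_mset G'" for k H G'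
    using less.hyps[of k m H \<Gamma>' D G'] that right right_sub by auto
  have IHR: "derivable S G' E" if "derh S k H E" "k < m" "set_mset H \<subseteq> insert \<phi> (set_mset G')"
    "set_mset G \<subseteq> set_mset G'" for k H E G'
    using less.hyps[of n k \<Gamma> H E G'] that left left_sub by auto
  have cut: "derivable S K E"
    if "derivable S H (Some \<chi>)" "derivable S L E" "size \<chi> < size \<phi>"
      "set_mset H \<subseteq> set_mset K" "set_mset L \<subseteq> insert \<chi> (set_mset K)"
    for \<chi> :: "'a form" and H K L E
  proof (rule smaller[OF that(3)])
    show "derivable S K (Some \<chi>)" using that(1,4) by (rule derivable_mono)
    show "derivable S (add_mset \<chi> K) E" using that(2) by (rule derivable_mono) (use that(5) in simp)
  qed
  \<comment> \<open>Transitivity is itself a cut, so at this stage it is available only through a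
    middle formula smaller than \<phi>, such as its antecedent.\<close>
  have equiv_trans: "equivalent S \<alpha> \<gamma>"
    if "equivalent S \<alpha> \<chi>" "equivalent S \<chi> \<gamma>" "size \<chi> < size \<phi>" for \<alpha> \<chi> \<gamma> :: "'a form"
    using that unfolding equivalent_def
    by (auto intro: cut[of "{#\<alpha>#}" \<chi> "{#\<chi>#}"] cut[of "{#\<gamma>#}" \<chi> "{#\<chi>#}"])
  have equivI: "equivh S k \<alpha> \<chi> \<Longrightarrow> equivalent S \<alpha> \<chi>" for k and \<alpha> \<chi> :: "'a form"
    by (auto simp: equivalent_iff)
  have derI: "derh S k H E \<Longrightarrow> derivable S H E" for k and H :: "'a form multiset" and E
    by (auto simp: derivable_def)
  \<comment> \<open>The modal cases abstract from the last rule on the right by keeping only a continuation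
    that reapplies it to modified premisses.\<close>
  consider
      (direct) "derivable S G D"
    | (bot) "\<phi> = Bot"
    | (conj) A B where "\<phi> = And A B" "derivable S (add_mset A (add_mset B G)) D"
    | (disj) A B where "\<phi> = Or A B" "derivable S (add_mset A G) D" "derivable S (add_mset B G) D"
    | (imp) A B where "\<phi> = Imp A B" "derivable S G (Some A)" "derivable S (add_mset B G) D"
    | (mp) \<alpha> \<beta> where "\<phi> = BoxArr \<alpha> \<beta>" "hasMP S" "derivable S G (Some \<alpha>)"
        "derivable S (add_mset \<beta> G) D"
    | (box) \<alpha> \<beta> \<chi> B X E where "\<phi> = BoxArr \<alpha> \<beta>" "equivalent S \<chi> \<alpha>"
        "\<forall>p\<in>#B. box_of p \<in># G \<and> equivalent S \<chi> (fst p)"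
        "derivable S (id_premiss S \<chi> + X + add_mset \<beta> (image_mset snd B)) E"
        "\<And>B'. \<forall>p\<in>#B'. box_of p \<in># G \<and> equivalent S \<chi> (fst p) \<Longrightarrow>
          derivable S (id_premiss S \<chi> + X + image_mset snd B') E \<Longrightarrow> derivable S G D"
    | (dia) \<alpha> \<beta> B E where "\<phi> = DiaArr \<alpha> \<beta>"
        "\<forall>p\<in>#B. box_of p \<in># G \<and> equivalent S \<alpha> (fst p)"
        "derivable S (id_premiss S \<alpha> + add_mset \<beta> (image_mset snd B)) E"
        "\<And>\<gamma> \<delta> B'. DiaArr \<gamma> \<delta> \<in># G \<Longrightarrow> equivalent S \<gamma> \<alpha> \<Longrightarrow>
          \<forall>p\<in>#B'. box_of p \<in># G \<and> equivalent S \<gamma> (fst p) \<Longrightarrow>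
          derivable S (id_premiss S \<gamma> + add_mset \<delta> (image_mset snd B')) E \<Longrightarrow> derivable S G D"
        "hasMP S \<Longrightarrow> derivable S G (Some \<alpha>) \<Longrightarrow> derivable S G E \<Longrightarrow> derivable S G D"
  proof -
    \<comment> \<open>Shared by the three conditional rules on the right: \<open>X\<close> is empty
      for \<open>box\<close> and holds the consequent of the principal diamond for the other two. If
      \<phi> is not among the boxes, the rule is reapplied over \<open>G\<close>; otherwise
      alternative \<open>box\<close> arises.\<close>
    have box_case: thesis
      if eqs: "\<forall>p\<in>#B. equivh S k \<chi> (fst p)" and sub: "\<forall>p\<in>#B. box_of p \<in> insert \<phi> (set_mset G)"
        and prem: "derh S k (id_premiss S \<chi> + X + image_mset snd B) E"
        and cont: "\<And>B'. \<forall>p\<in>#B'. box_of p \<in># G \<and> equivalent S \<chi> (fst p) \<Longrightarrow>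
          derivable S (id_premiss S \<chi> + X + image_mset snd B') E \<Longrightarrow> derivable S G D"
      for B :: "('a form \<times> 'a form) multiset" and k \<chi> X E
    proof -
      have eqs': "\<forall>p\<in>#B. equivalent S \<chi> (fst p)" using eqs equivI by blast
      show ?thesis
      proof (cases "\<exists>p\<in>#B. box_of p = \<phi>")
        case True
        then obtain p where p: "p \<in># B" "\<phi> = box_of p" by auto
        \<comment> \<open>All copies of \<open>p\<close> go at once, and one \<open>snd p\<close>
          stands for all their consequents. By injectivity of \<open>box_of\<close> the remaining
          boxes differ from \<phi>, hence lie in \<open>G\<close>.\<close>
        let ?B = "filter_mset (\<lambda>q. q \<noteq> p) B"
        have "derivable S (id_premiss S \<chi> + X + add_mset (snd p) (image_mset snd ?B)) E"
          by (rule derivable_mono[OF derI[OF prem]]) auto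
        moreover have "\<forall>q\<in>#?B. box_of q \<in># G \<and> equivalent S \<chi> (fst q)"
          using sub eqs' p(2) by (fastforce simp: prod_eq_iff)
        moreover have "equivalent S \<chi> (fst p)" using eqs' p(1) by blast
        ultimately show ?thesis using box[OF p(2), of \<chi> ?B X E] cont by blast
      next
        case False
        then have "\<forall>p\<in>#B. box_of p \<in># G \<and> equivalent S \<chi> (fst p)"
          using sub eqs' by fastforce
        then show ?thesis using direct cont derI[OF prem] by blast
      qed
    qed
    from right show ?thesis
    proof (cases rule: derh_cases)
      case (init p \<Gamma>0)
      \<comment> \<open>If the atom is \<phi> itself, the left premiss already derives
        \<open>D\<close>.\<close>
      then show ?thesis
        by (intro direct) (use right_sub left_der in \<open>auto intro: derivable_init\<close>)
    next
      case (botL \<Gamma>0)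
      \<comment> \<open>No rule introduces \<open>Bot\<close> on the right, so alternative
        \<open>bot\<close> will clash with every rule that could introduce \<phi> on the left side
        of the cut.\<close>
      then show ?thesis using right_sub by (auto intro: bot direct derivable_botL)
    next
      case (andL k A B \<Gamma>0)
      have "derivable S (add_mset A (add_mset B G)) D"
        by (rule IHR[OF andL(3)]) (use andL right_sub in auto)
      then show ?thesis using andL(2) right_sub by (auto intro: conj direct derivable_andL)
    next
      case (andR k A B)
      from IHR[OF andR(3)] IHR[OF andR(4)] show ?thesis
        by (intro direct) (use andR right_sub in \<open>auto intro: derivable_andR\<close>)
    next
      case (orL k A B \<Gamma>0)
      have "derivable S (add_mset A G) D"
        by (rule IHR[OF orL(3)]) (use orL right_sub in auto)
      moreover have "derivable S (add_mset B G) D"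
        by (rule IHR[OF orL(4)]) (use orL right_sub in auto)
      ultimately show ?thesis using orL(2) right_sub by (auto intro: disj direct derivable_orL)
    next
      case (orR1 k A B)
      from IHR[OF orR1(3)] show ?thesis
        by (intro direct) (use orR1 right_sub in \<open>auto intro: derivable_orR(1)\<close>)
    next
      case (orR2 k A B)
      from IHR[OF orR2(3)] show ?thesis
        by (intro direct) (use orR2 right_sub in \<open>auto intro: derivable_orR(2)\<close>)
    next
      case (impR k A B)
      have "derivable S (add_mset A G) (Some B)"
        by (rule IHR[OF impR(3)]) (use impR right_sub in auto)
      then show ?thesis by (intro direct) (simp add: impR(2) derivable_impR)
    next
      case (impL k A B \<Gamma>0)
      have "derivable S G (Some A)"
        by (rule IHR[OF impL(3)]) (use impL right_sub in auto)
      moreover have "derivable S (add_mset B G) D"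
        by (rule IHR[OF impL(4)]) (use impL right_sub in auto)
      ultimately show ?thesis using impL(2) right_sub by (auto intro: imp direct derivable_impL)
    next
      case (box k \<chi> \<psi> B \<Gamma>0)
      show ?thesis
        by (rule box_case[of B k \<chi> "{#}" "Some \<psi>"])
          (use box right_sub in \<open>auto intro: derivable_box\<close>)
    next
      case (dia k \<chi> \<psi> \<eta> \<theta> B \<Gamma>0)
      have sub: "\<forall>p\<in>#B. box_of p \<in> insert \<phi> (set_mset G)" using dia(2) right_sub by auto
      have eq: "equivalent S \<chi> \<eta>" using dia(5) by (rule equivI)
      show ?thesis
      proof (cases "DiaArr \<chi> \<psi> \<in># G")
        case True
        show ?thesis
          by (rule box_case[OF dia(4) sub, of "{#\<psi>#}" "Some \<theta>"])
            (use dia(6) True in \<open>auto simp: dia(3) intro: derivable_dia[OF True _ eq]\<close>)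
      next
        case False
        then have \<phi>: "\<phi> = DiaArr \<chi> \<psi>" using dia(2) right_sub by auto
        show ?thesis
        \<comment> \<open>This is alternative \<open>dia\<close>. As \<phi> is a diamond formula,
          all boxes used by the rule lie in \<open>G\<close>.\<close>
        proof (rule that(8)[OF \<phi> _ derI[OF dia(6)]])
          show "\<forall>p\<in>#B. box_of p \<in># G \<and> equivalent S \<chi> (fst p)"
            using sub dia(4) \<phi> by (auto intro: equivI)
        next
          fix \<gamma> \<delta> B'
          assume "DiaArr \<gamma> \<delta> \<in># G" "equivalent S \<gamma> \<chi>"
            "\<forall>p\<in>#B'. box_of p \<in># G \<and> equivalent S \<gamma> (fst p)"
            "derivable S (id_premiss S \<gamma> + add_mset \<delta> (image_mset snd B')) (Some \<theta>)"
          then show "derivable S G D"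
            using equiv_trans[of \<gamma> \<chi> \<eta>] eq \<phi> dia(3) derivable_dia by auto
        next
          assume mp: "hasMP S" "derivable S G (Some \<chi>)" "derivable S G (Some \<theta>)"
          \<comment> \<open>A cut on the antecedent carries derivability from \<chi> to the
            equivalent \<eta>, after which \<open>mpDia\<close> derives the succedent.\<close>
          have "derivable S G (Some \<eta>)"
            using mp(2) eq \<phi> by (auto simp: equivalent_def intro: cut[of G \<chi> "{#\<chi>#}"])
          then show "derivable S G D" using mp dia(3) by (simp add: derivable_mpDia)
        qed
      qed
    next
      case (boxdia k \<chi> \<psi> B \<Gamma>0)
      have sub: "\<forall>p\<in>#B. box_of p \<in> insert \<phi> (set_mset G)" using boxdia(2) right_sub by auto
      show ?thesis
      proof (cases "DiaArr \<chi> \<psi> \<in># G")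
        case True
        show ?thesis
          by (rule box_case[OF boxdia(3) sub, of "{#\<psi>#}" None])
            (use boxdia(4) True in \<open>auto intro: derivable_boxdia[OF True]\<close>)
      next
        case False
        then have \<phi>: "\<phi> = DiaArr \<chi> \<psi>" using boxdia(2) right_sub by auto
        show ?thesis
        proof (rule that(8)[OF \<phi> _ derI[OF boxdia(4)]])
          show "\<forall>p\<in>#B. box_of p \<in># G \<and> equivalent S \<chi> (fst p)"
            using sub boxdia(3) \<phi> by (auto intro: equivI)
        \<comment> \<open>Here \<open>E\<close> is \<open>None\<close>, so the modus ponens
          continuation is right weakening.\<close>
        qed (auto intro: derivable_boxdia derivable_weaken_right)
      qed
    next
      case (mpBox k \<alpha> \<beta> \<Gamma>0)
      have "derivable S G (Some \<alpha>)"
        by (rule IHR[OF mpBox(4)]) (use mpBox right_sub in auto)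
      moreover have "derivable S (add_mset \<beta> G) D"
        by (rule IHR[OF mpBox(5)]) (use mpBox right_sub in auto)
      ultimately show ?thesis
        using mpBox(2,3) right_sub by (auto intro: mp direct derivable_mpBox)
    next
      case (mpDia k A B)
      from IHR[OF mpDia(4)] IHR[OF mpDia(5)] show ?thesis
        by (intro direct) (use mpDia right_sub in \<open>auto intro: derivable_mpDia\<close>)
    qed
  qed
  note right_cases = this
  have weaken: "derivable S K E" if "derh S k \<Gamma> E" "set_mset G \<subseteq> set_mset K" for k E K
    using derivable_mono[OF derI[OF that(1)]] left_sub that(2) by blast
  \<comment> \<open>Left rules ending the left derivation commute with the cut. Only when \<phi> was
    just introduced on the right do the alternatives for the right derivation come into
    play.\<close>
  from left show ?case
  proof (cases rule: derh_cases)
    case (init p \<Gamma>0)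
    then show ?thesis by (auto intro: right_cases)
  next
    case (botL \<Gamma>0)
    then show ?thesis using left_sub by (auto intro: derivable_botL)
  next
    case (andL k A B \<Gamma>0)
    have "derivable S (add_mset A (add_mset B G)) D"
      by (rule IHL[OF andL(3)]) (use andL left_sub in auto)
    then show ?thesis using andL(2) left_sub by (auto intro: derivable_andL)
  next
    case (andR k A B)
    have "derivable S G D" if "derivable S (add_mset A (add_mset B G)) D"
    proof -
      have "derivable S (add_mset A G) D"
        by (rule cut[OF weaken[OF andR(4)] that]) (use andR(2) in auto)
      from cut[OF weaken[OF andR(3)] this] show ?thesis
        using andR(2) by auto
    qed
    with andR(2) show ?thesis by (auto intro: right_cases)
  next
    case (orL k A B \<Gamma>0)
    have "derivable S (add_mset A G) D"
      by (rule IHL[OF orL(3)]) (use orL left_sub in auto)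
    moreover have "derivable S (add_mset B G) D"
      by (rule IHL[OF orL(4)]) (use orL left_sub in auto)
    ultimately show ?thesis using orL(2) left_sub by (auto intro: derivable_orL)
  next
    case (orR1 k A B)
    have "derivable S G D" if "derivable S (add_mset A G) D"
      by (rule cut[OF weaken[OF orR1(3)] that]) (use orR1(2) in auto)
    with orR1(2) show ?thesis by (auto intro: right_cases)
  next
    case (orR2 k A B)
    have "derivable S G D" if "derivable S (add_mset B G) D"
      by (rule cut[OF weaken[OF orR2(3)] that]) (use orR2(2) in auto)
    with orR2(2) show ?thesis by (auto intro: right_cases)
  next
    case (impR k A B)
    have "derivable S G D" if "derivable S G (Some A)" "derivable S (add_mset B G) D"
    proof -
      have "derivable S G (Some B)"
        by (rule cut[OF that(1) derI[OF impR(3)]]) (use impR(2) left_sub in auto)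
      then show ?thesis by (rule cut[OF _ that(2)]) (use impR(2) in auto)
    qed
    with impR(2) show ?thesis by (auto intro: right_cases)
  next
    case (impL k A B \<Gamma>0)
    have "derivable S (add_mset B G) D"
      by (rule IHL[OF impL(4)]) (use impL left_sub in auto)
    moreover have "derivable S G (Some A)" by (rule weaken[OF impL(3)]) simp
    ultimately show ?thesis using impL(2) left_sub by (auto intro: derivable_impL)
  next
    case (box k \<alpha> \<beta> B \<Gamma>0)
    have \<phi>: "\<phi> = BoxArr \<alpha> \<beta>" using box(3) by simp
    have B: "\<forall>p\<in>#B. box_of p \<in># G \<and> equivalent S \<alpha> (fst p)"
      using box(2,4) left_sub by (auto intro: equivI)
    note prem = derI[OF box(5)]
    show ?thesis
    proof (cases rule: right_cases)
      case (mp \<alpha>' \<beta>')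
      then have mp: "hasMP S" "derivable S G (Some \<alpha>)" "derivable S (add_mset \<beta> G) D"
        using \<phi> by auto
      \<comment> \<open>In a calculus with identity this cut removes the assumption \<alpha>;
        without identity \<open>prem\<close> holds over the consequents of \<open>B\<close>
        alone.\<close>
      have "derivable S (image_mset snd B + G) (Some \<beta>)"
        by (rule cut[OF mp(2) prem]) (auto simp: \<phi> id_premiss_def)
      then have "derivable S (image_mset snd B + G) D"
        by (rule cut[OF _ mp(3)]) (auto simp: \<phi>)
      moreover have "derivable S G (Some (fst p))" if "p \<in># B" for p
        using B that \<phi> mp(2) by (auto simp: equivalent_def intro: cut[of G \<alpha> "{#\<alpha>#}"])
      ultimately show ?thesis
        using derivable_mpBox_multiset[OF mp(1), of B G D] B by auto
    next
      case (box \<alpha>' \<beta>' \<chi> B' X E)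
      then have eq: "equivalent S \<chi> \<alpha>"
        and prem': "derivable S (id_premiss S \<chi> + X + add_mset \<beta> (image_mset snd B')) E"
        using \<phi> by auto
      show ?thesis
      \<comment> \<open>The two conditional rules merge into one with boxes \<open>B + B'\<close>.
        The antecedents of \<open>B\<close> are equivalent to \<chi> through \<alpha>, and the cut
        moves to \<beta>, after an identity assumption \<alpha> has been traded for \<chi>.\<close>
      proof (rule box(5)[of "B + B'"])
        have "equivalent S \<chi> (fst p)" if "p \<in># B" for p
          using equiv_trans[OF eq, of "fst p"] B that \<phi> by simp
        with B have "\<forall>p\<in>#B. box_of p \<in># G \<and> equivalent S \<chi> (fst p)" by blast
        then show "\<forall>p\<in>#B + B'. box_of p \<in># G \<and> equivalent S \<chi> (fst p)"
          unfolding set_mset_union ball_Un using box(3) by (rule conjI)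
        have "derivable S (id_premiss S \<chi> + image_mset snd B) (Some \<beta>)"
        proof (cases "hasID S")
          case True
          have "derivable S {#\<chi>#} (Some \<alpha>)" using eq by (simp add: equivalent_def)
          then show ?thesis
            by (rule cut[OF _ prem]) (use True in \<open>auto simp: \<phi> id_premiss_def\<close>)
        qed (use prem in \<open>simp add: id_premiss_def\<close>)
        then show "derivable S (id_premiss S \<chi> + X + image_mset snd (B + B')) E"
          by (rule cut[OF _ prem']) (auto simp: \<phi>)
      qed
    qed (use \<phi> in auto)
  next
    case (dia k \<gamma> \<delta> \<alpha> \<beta> B \<Gamma>0)
    have \<phi>: "\<phi> = DiaArr \<alpha> \<beta>" using dia(3) by simp
    have B: "\<forall>p\<in>#B. box_of p \<in># G \<and> equivalent S \<gamma> (fst p)"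
      using dia(2,4) left_sub by (auto intro: equivI)
    have eq: "equivalent S \<gamma> \<alpha>" using dia(5) by (rule equivI)
    have mem: "DiaArr \<gamma> \<delta> \<in># G" using dia(2) left_sub by auto
    note prem = derI[OF dia(6)]
    show ?thesis
    proof (cases rule: right_cases)
      case (dia \<alpha>' \<beta>' B' E)
      then have prem': "derivable S (id_premiss S \<alpha> + add_mset \<beta> (image_mset snd B')) E"
        and B': "\<forall>p\<in>#B'. box_of p \<in># G \<and> equivalent S \<alpha> (fst p)"
        using \<phi> by auto
      let ?K = "id_premiss S \<gamma> + add_mset \<delta> (image_mset snd (B + B'))"
      show ?thesis
      proof (rule dia(4)[OF mem])
        show "equivalent S \<gamma> \<alpha>'" using eq \<phi> dia(1) by simp
        have "equivalent S \<gamma> (fst p)" if "p \<in># B'" for p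
          using equiv_trans[OF eq, of "fst p"] B' that \<phi> by simp
        with B' have "\<forall>p\<in>#B'. box_of p \<in># G \<and> equivalent S \<gamma> (fst p)" by blast
        with B show "\<forall>p\<in>#B + B'. box_of p \<in># G \<and> equivalent S \<gamma> (fst p)"
          unfolding set_mset_union ball_Un by (rule conjI)
        \<comment> \<open>Cutting on \<beta> can leave \<alpha> from the identity premiss of the
          right rule; it is then cut away using the derivation of \<alpha> from \<gamma>.\<close>
        have *: "derivable S (id_premiss S \<alpha> + ?K) E"
          by (rule cut[OF prem prem']) (auto simp: \<phi>)
        show "derivable S ?K E"
        proof (cases "hasID S")
          case True
          have "derivable S {#\<gamma>#} (Some \<alpha>)" using eq by (simp add: equivalent_def)
          then show ?thesis
            by (rule cut[OF _ *]) (use True in \<open>auto simp: \<phi> id_premiss_def\<close>)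
        qed (use * in \<open>simp add: id_premiss_def\<close>)
      qed
    qed (use \<phi> in auto)
  next
    case (boxdia k \<gamma> \<delta> B \<Gamma>0)
    \<comment> \<open>This rule admits any succedent, so it concludes \<open>D\<close> without the
      right premiss.\<close>
    then show ?thesis
      using left_sub by (auto intro!: derivable_boxdia[of \<gamma> \<delta> G B S D] intro: equivI derI)
  next
    case (mpBox k A B \<Gamma>0)
    have "derivable S (add_mset B G) D"
      by (rule IHL[OF mpBox(5)]) (use mpBox left_sub in auto)
    moreover have "derivable S G (Some A)" by (rule weaken[OF mpBox(4)]) simp
    ultimately show ?thesis using mpBox(2,3) left_sub by (auto intro: derivable_mpBox)
  next
    case (mpDia k \<alpha> \<beta>)
    have \<phi>: "\<phi> = DiaArr \<alpha> \<beta>" using mpDia(3) by simp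
    have \<alpha>: "derivable S G (Some \<alpha>)" and \<beta>: "derivable S G (Some \<beta>)"
      using weaken[OF mpDia(4)] weaken[OF mpDia(5)] by auto
    show ?thesis
    proof (cases rule: right_cases)
      case (dia \<alpha>' \<beta>' B E)
      then have prem: "derivable S (id_premiss S \<alpha> + add_mset \<beta> (image_mset snd B)) E"
        and B: "\<forall>p\<in>#B. box_of p \<in># G \<and> equivalent S \<alpha> (fst p)"
        using \<phi> by auto
      \<comment> \<open>After the cuts on \<beta> and \<alpha>, only the consequents of
        \<open>B\<close> remain. Their antecedents follow from \<alpha>, so \<open>mpBox\<close>
        discharges them, and the stored continuation gives \<open>D\<close>.\<close>
      have "derivable S (id_premiss S \<alpha> + (image_mset snd B + G)) E"
        by (rule cut[OF \<beta> prem]) (auto simp: \<phi>)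
      then have "derivable S (image_mset snd B + G) E"
        by (rule cut[OF \<alpha>]) (auto simp: \<phi> id_premiss_def)
      moreover have "derivable S G (Some (fst p))" if "p \<in># B" for p
        using B that \<phi> \<alpha> by (auto simp: equivalent_def intro: cut[of G \<alpha> "{#\<alpha>#}"])
      ultimately have "derivable S G E"
        using derivable_mpBox_multiset[OF mpDia(2), of B G E] B by auto
      then show ?thesis using dia(1,5) \<phi> \<alpha> mpDia(2) by auto
    qed (use \<phi> in auto)
  qed
qed

text \<open>The outer induction on the size of the cut formula supplies the assumption
  \<open>smaller\<close> of \<open>cut_step\<close>.\<close>

lemma derivable_cut:
  fixes \<phi> :: "'a form"
  shows "derivable S G (Some \<phi>) \<Longrightarrow> derivable S (add_mset \<phi> G) D \<Longrightarrow> derivable S G D"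
proof (induction "size \<phi>" arbitrary: \<phi> G D rule: less_induct)
  case less
  then obtain n m where nm: "derh S n G (Some \<phi>)" "derh S m (add_mset \<phi> G) D"
    by (auto simp: derivable_def)
  show ?case
  proof (rule cut_step[OF _ nm])
    show "derivable S H E" if "size \<chi> < size \<phi>" "derivable S H (Some \<chi>)"
      "derivable S (add_mset \<chi> H) E" for \<chi> :: "'a form" and H E
      using that by (rule less.hyps)
  qed auto
qed

section \<open>Admissibility of weakening, contraction and cut\<close>

theorem theorem10:
  fixes S :: calc
  shows "(\<forall>n \<Gamma> \<Delta> (\<phi> :: 'a form). derh S n \<Gamma> \<Delta> \<longrightarrow> derh S n (add_mset \<phi> \<Gamma>) \<Delta>)
       \<and> (\<forall>n \<Gamma> (\<phi> :: 'a form). derh S n \<Gamma> None \<longrightarrow> derh S n \<Gamma> (Some \<phi>))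
       \<and> (\<forall>n \<Gamma> \<Delta> (\<phi> :: 'a form). derh S n (add_mset \<phi> (add_mset \<phi> \<Gamma>)) \<Delta> \<longrightarrow> derh S n (add_mset \<phi> \<Gamma>) \<Delta>)
       \<and> (\<forall>\<Gamma> \<Gamma>' \<Delta> (\<phi> :: 'a form). derivable S \<Gamma> (Some \<phi>) \<longrightarrow> derivable S (add_mset \<phi> \<Gamma>') \<Delta>
              \<longrightarrow> derivable S (\<Gamma> + \<Gamma>') \<Delta>)"
proof (intro conjI allI impI)
  fix n \<Delta> \<phi> and \<Gamma> :: "'a form multiset"
  assume "derh S n \<Gamma> \<Delta>"
  then show "derh S n (add_mset \<phi> \<Gamma>) \<Delta>" by (rule derh_mono) auto
next
  fix n \<phi> and \<Gamma> :: "'a form multiset"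
  assume "derh S n \<Gamma> None"
  then show "derh S n \<Gamma> (Some \<phi>)" by (rule derh_weaken_right)
next
  fix n \<Delta> \<phi> and \<Gamma> :: "'a form multiset"
  assume "derh S n (add_mset \<phi> (add_mset \<phi> \<Gamma>)) \<Delta>"
  then show "derh S n (add_mset \<phi> \<Gamma>) \<Delta>" by (rule derh_mono) auto
next
  fix \<Delta> \<phi> and \<Gamma> \<Gamma>' :: "'a form multiset"
  assume *: "derivable S \<Gamma> (Some \<phi>)" "derivable S (add_mset \<phi> \<Gamma>') \<Delta>"
  \<comment> \<open>Weakening both premisses to the joint context reduces to the cut with a shared
    context.\<close>
  have "derivable S (\<Gamma> + \<Gamma>') (Some \<phi>)" using *(1) by (rule derivable_mono) auto
  moreover have "derivable S (add_mset \<phi> (\<Gamma> + \<Gamma>')) \<Delta>" using *(2) by (rule derivable_mono) auto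
  ultimately show "derivable S (\<Gamma> + \<Gamma>') \<Delta>" by (rule derivable_cut)
qed

end
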